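(* Let $b\in\mathbb R$ and $$\delta:=b-\frac1T\sum_{s=1}^T[r(s)-w(s)],\qquad \overset{\frown}{w}(t):=w(t)-r(t)+\frac{g_{\mathcal N}}{T}+b,\quad t=1,\dots,T.$$ Let $\boldsymbol\pi_0=(\pi(b,1),\dots,\pi(b,T))^\top$ be the leader's strategy given by $$\pi(b,t):=1+\frac1n+\frac{\nu_{\mathcal N}(t)}{\overset{\frown}{w}(t)},$$ and let $\boldsymbol\sigma=(\boldsymbol\sigma_1,\dots,\boldsymbol\sigma_n)^\top$ with $\boldsymbol\sigma_i:=\frac{g_i}{g_{\mathcal N}+T\delta}\big(\overset{\frown}{w}(1),\dots,\overset{\frown}{w}(T)\big)^\top$ for $i=1,\dots,n$. Assume that $$0<\overset{\frown}{w}(t)\le (g_{\mathcal N}+T\delta)\min_{i\in\mathcal N}\left\{\frac{\nu_i^{\max}}{g_i}\right\}\qquad\text{for all }1\le t\le T.$$ Then $\boldsymbol\sigma$ is a strict Nash equilibrium, and the unique Nash equilibrium, of the follower game when the leader's strategy is $\boldsymbol\pi_0$, and the leader's cost is $$u^l(\boldsymbol\pi_0,\boldsymbol\sigma)=\left(\frac{T\delta}{g_{\mathcal N}+T\delta}\right)^2\mathrm{Var}\big(\{w(t)-r(t)\}_{t=1}^T\big),$$ where $$\mathrm{Var}\big(\{w(t)-r(t)\}_{t=1}^T\big):=\frac1T\sum_{t=1}^T\Big(w(t)-r(t)-\frac1T\sum_{s=1}^T[w(s)-r(s)]\Big)^2 .$$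
   Context: Let $n,T$ be positive integers and $\mathcal N=\{1,\dots,n\}$ (followers, i.e. flexible electricity users). For each $i\in\mathcal N$ let $g_i>0$ (total demand) and $\nu_i^{\max}\ge g_i/T$ (maximal demand per time slot). Let $r(t),w(t)$, $t=1,\dots,T$, be given real sequences (demand of regular users, uncontrollable power generation). Put $g_{\mathcal N}=\sum_{i\in\mathcal N}g_i$. The number $b$ is a prediction of $\frac1T\sum_{s=1}^T[r(s)-w(s)]$ and $\delta$ is the prediction error. A strategy of follower $i$ is $\boldsymbol\nu_i=(\nu_i(1),\dots,\nu_i(T))^\top\in\mathbb R^T$; it is feasible if $\sum_{t=1}^T\nu_i(t)=g_i$ and $0\le\nu_i(t)\le\nu_i^{\max}$ for all $t$. Write $\boldsymbol\nu=(\boldsymbol\nu_1,\dots,\boldsymbol\nu_n)^\top$, $\boldsymbol\nu_{-i}$ for the strategies of all followers except $i$, and $\nu_{\mathcal N}(t)=\sum_{i\in\mathcal N}\nu_i(t)$. A leader's strategy is $\boldsymbol\pi=(\pi(1),\dots,\pi(T))^\top$, where $\pi(t)$ is a price that is a function of $\nu_{\mathcal N}(t),r(t),w(t)$. Follower game: given $\boldsymbol\pi$, each follower $i$ minimizes the cost $u_i^f(\boldsymbol\pi,\boldsymbol\nu_i,\boldsymbol\nu_{-i})=\sum_{t=1}^T\pi(t)\,\nu_i(t)$ (where $\pi(t)$ is evaluated at the total demand $\nu_{\mathcal N}(t)$) over its feasible strategies. A feasible combination $\boldsymbol\nu$ is a Nash equilibrium if $u_i^f(\boldsymbol\pi,\boldsymbol\nu_i',\boldsymbol\nu_{-i})\ge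 u_i^f(\boldsymbol\pi,\boldsymbol\nu_i,\boldsymbol\nu_{-i})$ for every $i$ and every feasible $\boldsymbol\nu_i'$; it is strict if the inequality is strict whenever $\boldsymbol\nu_i'\ne\boldsymbol\nu_i$. Leader's cost: with $c(t)=\nu_{\mathcal N}(t)+r(t)-w(t)$ and $\bar c=\frac1T\sum_{t=1}^Tc(t)$, $u^l(\boldsymbol\pi,\boldsymbol\nu)=\frac1T\sum_{t=1}^T[c(t)-\bar c]^2$. *)

theory Defs
  imports "HOL-Analysis.Analysis"
begin

text \<open>
  The finite type \<open>'n\<close> indexes the followers (\<open>n = CARD('n)\<close>) and the finite type \<open>'t\<close> the time
  slots (\<open>T = CARD('t)\<close>); both are positive since types are nonempty. A combination of follower
  strategies is \<open>\<nu> :: real ^ 't ^ 'n\<close>, with \<open>\<nu> $ i $ t\<close> standing for \<open>\<nu>\<^sub>i(t)\<close>.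

  The sequences \<open>r\<close> and \<open>w\<close> are fixed data, so a price that is a function of the total demand
  \<open>\<nu>\<^sub>N(t)\<close> and of \<open>r(t)\<close>, \<open>w(t)\<close> is a function of \<open>t\<close> and of the total demand: a leader's strategy
  is \<open>\<pi> :: 't \<Rightarrow> real \<Rightarrow> real\<close>, where \<open>\<pi> t x\<close> is the price in slot \<open>t\<close> at total demand \<open>x\<close>.
\<close>

definition mean :: "real ^ 't::finite \<Rightarrow> real" where
  "mean x = (\<Sum>t\<in>UNIV. x $ t) / real CARD('t)"

definition Var :: "real ^ 't::finite \<Rightarrow> real" where
  "Var x = (\<Sum>t\<in>UNIV. (x $ t - mean x)\<^sup>2) / real CARD('t)"

definition total_demand :: "real ^ 't::finite ^ 'n::finite \<Rightarrow> real ^ 't" where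
  "total_demand \<nu> = (\<chi> t. \<Sum>i\<in>UNIV. \<nu> $ i $ t)"

definition feasible ::
  "real ^ 'n::finite \<Rightarrow> real ^ 'n \<Rightarrow> 'n \<Rightarrow> real ^ 't::finite \<Rightarrow> bool" where
  "feasible g \<nu>max i x \<longleftrightarrow>
     (\<Sum>t\<in>UNIV. x $ t) = g $ i \<and> (\<forall>t. 0 \<le> x $ t \<and> x $ t \<le> \<nu>max $ i)"

text \<open>The combination \<open>(\<nu>\<^sub>i', \<nu>\<^sub>-\<^sub>i)\<close>:\<close>

definition deviate ::
  "real ^ 't::finite ^ 'n::finite \<Rightarrow> 'n \<Rightarrow> real ^ 't \<Rightarrow> real ^ 't ^ 'n" where
  "deviate \<nu> i x = (\<chi> j. if j = i then x else \<nu> $ j)"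

definition follower_cost ::
  "('t::finite \<Rightarrow> real \<Rightarrow> real) \<Rightarrow> 'n::finite \<Rightarrow> real ^ 't ^ 'n \<Rightarrow> real" where
  "follower_cost \<pi> i \<nu> = (\<Sum>t\<in>UNIV. \<pi> t (total_demand \<nu> $ t) * \<nu> $ i $ t)"

definition nash_equilibrium ::
  "real ^ 'n::finite \<Rightarrow> real ^ 'n \<Rightarrow> ('t::finite \<Rightarrow> real \<Rightarrow> real) \<Rightarrow> real ^ 't ^ 'n \<Rightarrow> bool" where
  "nash_equilibrium g \<nu>max \<pi> \<nu> \<longleftrightarrow>
     (\<forall>i. feasible g \<nu>max i (\<nu> $ i)) \<and>
     (\<forall>i x. feasible g \<nu>max i x \<longrightarrow>
        follower_cost \<pi> i (deviate \<nu> i x) \<ge> follower_cost \<pi> i \<nu>)"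

definition strict_nash_equilibrium ::
  "real ^ 'n::finite \<Rightarrow> real ^ 'n \<Rightarrow> ('t::finite \<Rightarrow> real \<Rightarrow> real) \<Rightarrow> real ^ 't ^ 'n \<Rightarrow> bool" where
  "strict_nash_equilibrium g \<nu>max \<pi> \<nu> \<longleftrightarrow>
     nash_equilibrium g \<nu>max \<pi> \<nu> \<and>
     (\<forall>i x. feasible g \<nu>max i x \<and> x \<noteq> \<nu> $ i \<longrightarrow>
        follower_cost \<pi> i (deviate \<nu> i x) > follower_cost \<pi> i \<nu>)"

text \<open>The leader's cost depends on \<open>\<pi>\<close> only through the demands \<open>\<nu>\<close>.\<close>

definition leader_cost ::
  "real ^ 't::finite \<Rightarrow> real ^ 't \<Rightarrow> ('t \<Rightarrow> real \<Rightarrow> real) \<Rightarrow> real ^ 't ^ 'n::finite \<Rightarrow> real" where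
  "leader_cost r w \<pi> \<nu> =
     (let c = total_demand \<nu> + r - w
      in (\<Sum>t\<in>UNIV. (c $ t - mean c)\<^sup>2) / real CARD('t))"

definition total_need :: "real ^ 'n::finite \<Rightarrow> real" where
  "total_need g = (\<Sum>i\<in>UNIV. g $ i)"

definition prediction_error :: "real ^ 't::finite \<Rightarrow> real ^ 't \<Rightarrow> real \<Rightarrow> real" where
  "prediction_error r w b = b - mean (r - w)"

definition w_arc ::
  "real ^ 'n::finite \<Rightarrow> real ^ 't::finite \<Rightarrow> real ^ 't \<Rightarrow> real \<Rightarrow> real ^ 't" where
  "w_arc g r w b = (\<chi> t. w $ t - r $ t + total_need g / real CARD('t) + b)"

definition leader_strategy ::
  "real ^ 'n::finite \<Rightarrow> real ^ 't::finite \<Rightarrow> real ^ 't \<Rightarrow> real \<Rightarrow> 't \<Rightarrow> real \<Rightarrow> real" where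
  "leader_strategy g r w b t x = 1 + 1 / real CARD('n) + x / (w_arc g r w b $ t)"

definition sigma_profile ::
  "real ^ 'n::finite \<Rightarrow> real ^ 't::finite \<Rightarrow> real ^ 't \<Rightarrow> real \<Rightarrow> real ^ 't ^ 'n" where
  "sigma_profile g r w b =
     (\<chi> i. (g $ i / (total_need g + real CARD('t) * prediction_error r w b)) *\<^sub>R w_arc g r w b)"

end

theory Submission
  imports Defs
begin

text \<open>
  Write \<open>W\<close> for \<^const>\<open>w_arc\<close>, let \<open>N\<close> be the total demand of a profile \<open>\<nu>\<close>, and consider any price
  of the form \<open>a + x / W(t)\<close>, with \<open>W\<close> positive. Every feasible strategy of follower \<open>i\<close> has the
  same sum over the slots, so a deviation \<open>d\<close> of follower \<open>i\<close> satisfies \<open>\<Sum>\<^sub>t d(t) = 0\<close>, the constant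
  \<open>a\<close> does not matter, and the cost of \<open>i\<close> changes by
  \<open>\<Sum>\<^sub>t d(t) (N(t) + \<nu>\<^sub>i(t)) / W(t) + \<Sum>\<^sub>t d(t)\<^sup>2 / W(t)\<close> (lemma \<open>follower_cost_deviate\<close>).

  If all strategies are proportional to \<open>W\<close>, then so is \<open>N + \<nu>\<^sub>i\<close>; the linear term is then a multiple
  of \<open>\<Sum>\<^sub>t d(t)\<close> and vanishes. What remains is a positive definite quadratic form, hence such a profile
  is a strict equilibrium.

  For uniqueness, let \<open>\<nu>\<close> be an equilibrium, \<open>\<sigma>\<close> the proportional profile, and let each follower move
  a little from \<open>\<nu>\<^sub>i\<close> towards \<open>\<sigma>\<^sub>i\<close>. With \<open>e\<^sub>i = \<sigma>\<^sub>i - \<nu>\<^sub>i\<close> and \<open>E = \<Sum>\<^sub>i e\<^sub>i\<close>, the first-order condition is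
  \<open>\<Sum>\<^sub>t e\<^sub>i(t) (E(t) + e\<^sub>i(t)) / W(t) \<le> 0\<close>. Summing over \<open>i\<close> gives
  \<open>\<Sum>\<^sub>t (E(t)\<^sup>2 + \<Sum>\<^sub>i e\<^sub>i(t)\<^sup>2) / W(t) \<le> 0\<close>, so every \<open>e\<^sub>i\<close> is zero.

  It remains to see that the profile in the theorem is feasible: the entries of \<open>W\<close> add up to
  \<open>g\<^sub>N + T \<delta>\<close>, which makes \<open>\<sigma>\<^sub>i\<close> meet the demand \<open>g\<^sub>i\<close>, and the upper bound assumed on \<open>W\<close> is the
  capacity constraint. In the leader's cost, \<open>W\<close> and \<open>w - r\<close> differ by a constant, so \<open>c\<close> is up to a
  constant \<open>(g\<^sub>N / (g\<^sub>N + T \<delta>) - 1) (w - r)\<close>, and the variance scales by the square of the factor.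
\<close>

section \<open>The effect of a unilateral deviation\<close>

lemma total_demand_deviate:
  "total_demand (deviate \<nu> i x) $ t = total_demand \<nu> $ t + (x $ t - \<nu> $ i $ t)"
proof -
  have "(\<Sum>j\<in>UNIV. deviate \<nu> i x $ j $ t)
      = (\<Sum>j\<in>UNIV. \<nu> $ j $ t + (if j = i then x $ t - \<nu> $ i $ t else 0))"
    by (intro sum.cong) (auto simp: deviate_def)
  then show ?thesis
    by (simp add: total_demand_def sum.distrib)
qed

text \<open>
  The price is affine in the total demand, so the cost is quadratic in the deviation and its
  second-order expansion is exact. The sum \<open>N + \<nu>\<^sub>i\<close> in the linear term combines the current price with
  the influence of follower \<open>i\<close> on the price of its own demand.
\<close>

lemma follower_cost_deviate:
  fixes W :: "real ^ 't::finite" and \<nu> :: "real ^ 't ^ 'n::finite"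
  assumes "(\<Sum>t\<in>UNIV. x $ t) = (\<Sum>t\<in>UNIV. \<nu> $ i $ t)"
  shows "follower_cost (\<lambda>t y. a + y / W $ t) i (deviate \<nu> i x) =
    follower_cost (\<lambda>t y. a + y / W $ t) i \<nu> +
    (\<Sum>t\<in>UNIV. (x $ t - \<nu> $ i $ t) * (total_demand \<nu> $ t + \<nu> $ i $ t) / W $ t) +
    (\<Sum>t\<in>UNIV. (x $ t - \<nu> $ i $ t)\<^sup>2 / W $ t)"
proof -
  have "follower_cost (\<lambda>t y. a + y / W $ t) i (deviate \<nu> i x) =
    (\<Sum>t\<in>UNIV. (a + (total_demand \<nu> $ t + (x $ t - \<nu> $ i $ t)) / W $ t) * x $ t)"
    by (simp add: follower_cost_def total_demand_deviate) (simp add: deviate_def)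
  also have "\<dots> = (\<Sum>t\<in>UNIV. (a + total_demand \<nu> $ t / W $ t) * \<nu> $ i $ t +
      (x $ t - \<nu> $ i $ t) * (total_demand \<nu> $ t + \<nu> $ i $ t) / W $ t +
      (x $ t - \<nu> $ i $ t)\<^sup>2 / W $ t + a * (x $ t - \<nu> $ i $ t))"
    by (intro sum.cong refl)
       (simp add: power2_eq_square divide_inverse algebra_simps)
  also have "(\<Sum>t\<in>UNIV. a * (x $ t - \<nu> $ i $ t)) = 0"
    using assms by (simp add: sum_distrib_left[symmetric] sum_subtractf)
  then have "(\<Sum>t\<in>UNIV. (a + total_demand \<nu> $ t / W $ t) * \<nu> $ i $ t +
      (x $ t - \<nu> $ i $ t) * (total_demand \<nu> $ t + \<nu> $ i $ t) / W $ t +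
      (x $ t - \<nu> $ i $ t)\<^sup>2 / W $ t + a * (x $ t - \<nu> $ i $ t)) =
      (\<Sum>t\<in>UNIV. (a + total_demand \<nu> $ t / W $ t) * \<nu> $ i $ t) +
      (\<Sum>t\<in>UNIV. (x $ t - \<nu> $ i $ t) * (total_demand \<nu> $ t + \<nu> $ i $ t) / W $ t) +
      (\<Sum>t\<in>UNIV. (x $ t - \<nu> $ i $ t)\<^sup>2 / W $ t)"
    by (simp add: sum.distrib)
  finally show ?thesis
    by (simp add: follower_cost_def)
qed

section \<open>Profiles proportional to the available power\<close>

text \<open>
  A proportional profile equalizes the marginal costs \<open>(N(t) + \<sigma>\<^sub>i(t)) / W(t)\<close> over the slots, so moving
  demand between slots changes nothing to first order.
\<close>

lemma marginal_cost_proportional: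
  fixes W :: "real ^ 't::finite" and k :: "real ^ 'n::finite"
  assumes W: "\<And>t. W $ t > 0"
    and d: "(\<Sum>t\<in>UNIV. d $ t) = 0"
  shows "(\<Sum>t\<in>UNIV. d $ t * (total_demand (\<chi> j. k $ j *\<^sub>R W) $ t + (k $ i *\<^sub>R W) $ t) / W $ t) = 0"
proof -
  have "d $ t * (total_demand (\<chi> j. k $ j *\<^sub>R W) $ t + (k $ i *\<^sub>R W) $ t) / W $ t
      = d $ t * ((\<Sum>j\<in>UNIV. k $ j) + k $ i)" for t
    using W[of t]
    by (simp add: total_demand_def sum_distrib_right[symmetric] field_simps)
  then show ?thesis
    using d by (simp add: sum_distrib_right[symmetric])
qed

lemma weighted_square_sum_pos:
  fixes W d :: "real ^ 't::finite"
  assumes W: "\<And>t. W $ t > 0" and "d \<noteq> 0"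
  shows "(\<Sum>t\<in>UNIV. (d $ t)\<^sup>2 / W $ t) > 0"
proof -
  obtain s where "d $ s \<noteq> 0"
    using \<open>d \<noteq> 0\<close> by (auto simp: vec_eq_iff)
  then show ?thesis
    using W by (intro sum_pos2[of UNIV s]) (auto intro!: divide_nonneg_pos)
qed

lemma proportional_strict_nash_equilibrium:
  fixes W :: "real ^ 't::finite" and k :: "real ^ 'n::finite"
  assumes W: "\<And>t. W $ t > 0"
    and feas: "\<And>i. feasible g \<nu>max i (k $ i *\<^sub>R W)"
  shows "strict_nash_equilibrium g \<nu>max (\<lambda>t y. a + y / W $ t) (\<chi> i. k $ i *\<^sub>R W)"
proof -
  define \<pi> where "\<pi> = (\<lambda>t y. a + y / W $ t)"
  define \<sigma> where "\<sigma> = (\<chi> i. k $ i *\<^sub>R W)"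
  have \<sigma>i: "\<sigma> $ i = k $ i *\<^sub>R W" for i
    by (simp add: \<sigma>_def)
  have strict: "follower_cost \<pi> i (deviate \<sigma> i x) > follower_cost \<pi> i \<sigma>"
    if x: "feasible g \<nu>max i x" "x \<noteq> \<sigma> $ i" for i x
  proof -
    have sums: "(\<Sum>t\<in>UNIV. x $ t) = (\<Sum>t\<in>UNIV. \<sigma> $ i $ t)"
      using x(1) feas[of i] by (simp add: feasible_def \<sigma>i)
    have "(\<Sum>t\<in>UNIV. (x $ t - \<sigma> $ i $ t) * (total_demand \<sigma> $ t + \<sigma> $ i $ t) / W $ t) = 0"
      using marginal_cost_proportional[OF W, of "x - \<sigma> $ i" k i] sums
      by (simp add: \<sigma>_def[symmetric] \<sigma>i[symmetric] sum_subtractf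
          del: vector_scaleR_component)
    moreover have "(\<Sum>t\<in>UNIV. (x $ t - \<sigma> $ i $ t)\<^sup>2 / W $ t) > 0"
      using weighted_square_sum_pos[OF W, of "x - \<sigma> $ i"] x(2) by simp
    ultimately show ?thesis
      using follower_cost_deviate[OF sums, of a W] by (simp add: \<pi>_def)
  qed
  moreover have "deviate \<sigma> i (\<sigma> $ i) = \<sigma>" for i
    by (simp add: deviate_def vec_eq_iff)
  ultimately have "nash_equilibrium g \<nu>max \<pi> \<sigma>"
    unfolding nash_equilibrium_def using feas
    by (metis \<sigma>i less_imp_le order_refl)
  then show ?thesis
    using strict by (simp add: strict_nash_equilibrium_def \<pi>_def \<sigma>_def)
qed

section \<open>Uniqueness of the equilibrium\<close>

lemma feasible_convex:
  assumes x: "feasible g \<nu>max i x" and y: "feasible g \<nu>max i y" and \<epsilon>: "0 \<le> \<epsilon>" "\<epsilon> \<le> 1"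
  shows "feasible g \<nu>max i (x + \<epsilon> *\<^sub>R (y - x))"
proof -
  have "0 \<le> x $ t + \<epsilon> * (y $ t - x $ t) \<and> x $ t + \<epsilon> * (y $ t - x $ t) \<le> \<nu>max $ i" for t
  proof -
    have "x $ t + \<epsilon> * (y $ t - x $ t) = (1 - \<epsilon>) * x $ t + \<epsilon> * y $ t"
      by (simp add: algebra_simps)
    moreover have "(1 - \<epsilon>) * x $ t + \<epsilon> * y $ t \<le> \<nu>max $ i"
      using x y \<epsilon> by (intro convex_bound_le) (auto simp: feasible_def)
    ultimately show ?thesis
      using x y \<epsilon> by (simp add: feasible_def)
  qed
  then show ?thesis
    using x y
    by (simp add: feasible_def sum.distrib sum_distrib_left[symmetric] sum_subtractf)
qed

text \<open>
  The variational inequality satisfied by an equilibrium: the segment from \<open>\<nu>\<^sub>i\<close> to a feasible \<open>x\<close> is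
  feasible, and near \<open>\<nu>\<^sub>i\<close> the quadratic term is of smaller order than the linear one.
\<close>

lemma nash_equilibrium_first_order:
  fixes W :: "real ^ 't::finite"
  assumes nash: "nash_equilibrium g \<nu>max (\<lambda>t y. a + y / W $ t) \<nu>"
    and W: "\<And>t. W $ t > 0"
    and x: "feasible g \<nu>max i x"
  shows "(\<Sum>t\<in>UNIV. (x $ t - \<nu> $ i $ t) * (total_demand \<nu> $ t + \<nu> $ i $ t) / W $ t) \<ge> 0"
    (is "?L \<ge> 0")
proof (rule ccontr)
  define Q where "Q = (\<Sum>t\<in>UNIV. (x $ t - \<nu> $ i $ t)\<^sup>2 / W $ t)"
  assume "\<not> ?L \<ge> 0"
  then have L: "?L < 0"
    by simp
  have "Q \<ge> 0"
    unfolding Q_def using W by (intro sum_nonneg) (auto intro!: divide_nonneg_pos)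
  \<comment> \<open>On the segment the cost changes by \<open>\<epsilon> (L + \<epsilon> Q)\<close>; this step size makes \<open>\<epsilon> Q\<close> less than \<open>- L\<close>
     and is at most 1.\<close>
  define \<epsilon> where "\<epsilon> = - ?L / (Q - ?L)"
  have \<epsilon>: "0 < \<epsilon>" "\<epsilon> \<le> 1"
    using L \<open>Q \<ge> 0\<close> by (auto simp: \<epsilon>_def field_simps)
  have "\<epsilon> * Q < - ?L"
    using L \<open>Q \<ge> 0\<close> by (simp add: \<epsilon>_def field_simps mult_neg_neg)
  define z where "z = \<nu> $ i + \<epsilon> *\<^sub>R (x - \<nu> $ i)"
  have \<nu>i: "feasible g \<nu>max i (\<nu> $ i)"
    using nash by (simp add: nash_equilibrium_def)
  have z: "feasible g \<nu>max i z"
    unfolding z_def using \<nu>i x \<epsilon> by (intro feasible_convex) auto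
  have "(\<Sum>t\<in>UNIV. z $ t) = (\<Sum>t\<in>UNIV. \<nu> $ i $ t)"
    using z \<nu>i by (simp add: feasible_def)
  from follower_cost_deviate[OF this, of a W] nash z
  have "0 \<le> (\<Sum>t\<in>UNIV. (z $ t - \<nu> $ i $ t) * (total_demand \<nu> $ t + \<nu> $ i $ t) / W $ t) +
      (\<Sum>t\<in>UNIV. (z $ t - \<nu> $ i $ t)\<^sup>2 / W $ t)"
    by (fastforce simp: nash_equilibrium_def)
  also have "\<dots> = \<epsilon> * ?L + \<epsilon>\<^sup>2 * Q"
    by (simp add: z_def Q_def sum_distrib_left power_mult_distrib mult.assoc)
  also have "\<dots> = \<epsilon> * (?L + \<epsilon> * Q)"
    by (simp add: power2_eq_square algebra_simps)
  also have "\<dots> < 0"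
    using \<epsilon> \<open>\<epsilon> * Q < - ?L\<close> by (intro mult_pos_neg) auto
  finally show False
    by simp
qed

text \<open>
  The marginal costs form a strictly monotone operator: pairing the difference of two profiles with
  the difference of their marginal costs gives the sum of the two quadratic forms below, which is
  positive unless the profiles agree. Strict monotonicity and the variational inequality together
  leave room for only one equilibrium.
\<close>

lemma nash_equilibrium_unique:
  fixes W :: "real ^ 't::finite" and k :: "real ^ 'n::finite"
  assumes W: "\<And>t. W $ t > 0"
    and feas: "\<And>i. feasible g \<nu>max i (k $ i *\<^sub>R W)"
    and nash: "nash_equilibrium g \<nu>max (\<lambda>t y. a + y / W $ t) \<nu>"
  shows "\<nu> = (\<chi> i. k $ i *\<^sub>R W)"
proof -
  define \<sigma> where "\<sigma> = (\<chi> i. k $ i *\<^sub>R W)"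
  have \<sigma>i: "\<sigma> $ i = k $ i *\<^sub>R W" for i
    by (simp add: \<sigma>_def)
  define e where "e = \<sigma> - \<nu>"
  define E where "E = total_demand e"
  have first_order: "(\<Sum>t\<in>UNIV. e $ i $ t * (E $ t + e $ i $ t) / W $ t) \<le> 0" for i
  proof -
    have "(\<Sum>t\<in>UNIV. e $ i $ t) = 0"
      using feas[of i] nash
      by (simp add: e_def \<sigma>i sum_subtractf feasible_def nash_equilibrium_def)
    then have "(\<Sum>t\<in>UNIV. e $ i $ t * (total_demand \<sigma> $ t + \<sigma> $ i $ t) / W $ t) = 0"
      using marginal_cost_proportional[OF W, of "e $ i" k i] by (simp add: \<sigma>_def)
    moreover have "(\<Sum>t\<in>UNIV. e $ i $ t * (total_demand \<nu> $ t + \<nu> $ i $ t) / W $ t) \<ge> 0"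
      using nash_equilibrium_first_order[OF nash W, of i "\<sigma> $ i"] feas[of i]
      by (simp add: e_def \<sigma>i)
    moreover have E: "E $ t = total_demand \<sigma> $ t - total_demand \<nu> $ t" for t
      by (simp add: E_def e_def total_demand_def sum_subtractf)
    have "e $ i $ t * (E $ t + e $ i $ t) / W $ t =
        e $ i $ t * (total_demand \<sigma> $ t + \<sigma> $ i $ t) / W $ t -
        e $ i $ t * (total_demand \<nu> $ t + \<nu> $ i $ t) / W $ t" for t
      by (simp add: e_def E diff_divide_distrib[symmetric]) (simp add: algebra_simps)
    ultimately show ?thesis
      by (simp add: sum_subtractf)
  qed
  have "(\<Sum>t\<in>UNIV. (E $ t)\<^sup>2 / W $ t) + (\<Sum>i\<in>UNIV. \<Sum>t\<in>UNIV. (e $ i $ t)\<^sup>2 / W $ t)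
      = (\<Sum>i\<in>UNIV. \<Sum>t\<in>UNIV. e $ i $ t * (E $ t + e $ i $ t) / W $ t)"
  proof -
    have "(\<Sum>t\<in>UNIV. (E $ t)\<^sup>2 / W $ t)
        = (\<Sum>t\<in>UNIV. \<Sum>i\<in>UNIV. e $ i $ t * E $ t / W $ t)"
      by (simp add: E_def total_demand_def power2_eq_square sum_distrib_right sum_divide_distrib)
    also have "\<dots> = (\<Sum>i\<in>UNIV. \<Sum>t\<in>UNIV. e $ i $ t * E $ t / W $ t)"
      by (rule sum.swap)
    finally show ?thesis
      by (simp add: sum.distrib[symmetric] add_divide_distrib[symmetric] power2_eq_square
          algebra_simps)
  qed
  also have "\<dots> \<le> 0"
    by (intro sum_nonpos first_order)
  finally have "(\<Sum>t\<in>UNIV. (E $ t)\<^sup>2 / W $ t) + (\<Sum>i\<in>UNIV. \<Sum>t\<in>UNIV. (e $ i $ t)\<^sup>2 / W $ t) \<le> 0" .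
  moreover have "(\<Sum>t\<in>UNIV. (E $ t)\<^sup>2 / W $ t) \<ge> 0"
    using W by (intro sum_nonneg) (auto intro!: divide_nonneg_pos)
  moreover have nonneg: "(\<Sum>t\<in>UNIV. (e $ i $ t)\<^sup>2 / W $ t) \<ge> 0" for i
    using W by (intro sum_nonneg) (auto intro!: divide_nonneg_pos)
  then have "(\<Sum>i\<in>UNIV. \<Sum>t\<in>UNIV. (e $ i $ t)\<^sup>2 / W $ t) \<ge> 0"
    by (rule sum_nonneg)
  ultimately have "(\<Sum>i\<in>UNIV. \<Sum>t\<in>UNIV. (e $ i $ t)\<^sup>2 / W $ t) = 0"
    by linarith
  then have "(\<Sum>t\<in>UNIV. (e $ i $ t)\<^sup>2 / W $ t) = 0" for i
    using nonneg by (simp add: sum_nonneg_eq_0_iff)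
  then have "e $ i = 0" for i
    using weighted_square_sum_pos[OF W, of "e $ i"] by fastforce
  then have "e = 0"
    by (simp add: vec_eq_iff)
  then show ?thesis
    by (simp add: e_def \<sigma>_def)
qed

section \<open>Feasibility and the leader's cost\<close>

lemma sum_w_arc:
  fixes g :: "real ^ 'n::finite" and r w :: "real ^ 't::finite"
  shows "(\<Sum>t\<in>UNIV. w_arc g r w b $ t) =
    total_need g + real CARD('t) * prediction_error r w b"
  by (simp add: w_arc_def prediction_error_def mean_def sum.distrib sum_subtractf)
     (simp add: field_simps)

lemma sum_w_arc_pos:
  fixes g :: "real ^ 'n::finite" and r w :: "real ^ 't::finite"
  assumes "\<And>t. 0 < w_arc g r w b $ t"
  shows "total_need g + real CARD('t) * prediction_error r w b > 0"
  using assms sum_w_arc[of g r w b] by (metis UNIV_not_empty finite sum_pos)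

lemma feasible_sigma_profile:
  fixes g \<nu>max :: "real ^ 'n::finite" and r w :: "real ^ 't::finite"
  assumes g: "\<And>i. g $ i > 0"
    and W: "\<And>t. 0 < w_arc g r w b $ t"
    and bound: "\<And>t. w_arc g r w b $ t \<le>
           (total_need g + real CARD('t) * prediction_error r w b) *
           Min (range (\<lambda>i. \<nu>max $ i / g $ i))"
  shows "feasible g \<nu>max i (sigma_profile g r w b $ i)"
proof -
  define S where "S = total_need g + real CARD('t) * prediction_error r w b"
  have S: "S > 0"
    unfolding S_def using sum_w_arc_pos[OF W] .
  have "g $ i / S * w_arc g r w b $ t \<le> \<nu>max $ i" for t
  proof -
    have "Min (range (\<lambda>i. \<nu>max $ i / g $ i)) \<le> \<nu>max $ i / g $ i"
      by (intro Min_le) auto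
    then have "S * Min (range (\<lambda>i. \<nu>max $ i / g $ i)) \<le> S * (\<nu>max $ i / g $ i)"
      using S by (intro mult_left_mono) auto
    with bound[of t] have "w_arc g r w b $ t \<le> S * (\<nu>max $ i / g $ i)"
      by (simp add: S_def)
    then show ?thesis
      using S g[of i] by (simp add: field_simps)
  qed
  moreover have "(\<Sum>t\<in>UNIV. g $ i / S * w_arc g r w b $ t) = g $ i"
    using S by (simp only: sum_distrib_left[symmetric] sum_w_arc S_def[symmetric]) simp
  moreover have "0 \<le> g $ i / S * w_arc g r w b $ t" for t
    using S g[of i] W[of t] by simp
  ultimately show ?thesis
    by (simp add: feasible_def sigma_profile_def S_def)
qed

lemma Var_affine:
  fixes x :: "real ^ 't::finite"
  shows "Var (\<chi> t. m * x $ t + c) = m\<^sup>2 * Var x"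
proof -
  have "mean (\<chi> t. m * x $ t + c) = m * mean x + c"
    by (simp add: mean_def sum.distrib sum_distrib_left[symmetric] add_divide_distrib)
  then have "((\<chi> t. m * x $ t + c) $ t - mean (\<chi> t. m * x $ t + c))\<^sup>2 = m\<^sup>2 * (x $ t - mean x)\<^sup>2" for t
    by (simp add: power_mult_distrib[symmetric] right_diff_distrib)
  then show ?thesis
    by (simp add: Var_def sum_distrib_left[symmetric])
qed

lemma leader_cost_sigma_profile:
  fixes g :: "real ^ 'n::finite" and r w :: "real ^ 't::finite"
  assumes S: "total_need g + real CARD('t) * prediction_error r w b \<noteq> 0"
  shows "leader_cost r w \<pi> (sigma_profile g r w b) =
    (real CARD('t) * prediction_error r w b /
      (total_need g + real CARD('t) * prediction_error r w b))\<^sup>2 * Var (w - r)"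
proof -
  define D where "D = real CARD('t) * prediction_error r w b"
  define G where "G = total_need g"
  define c where "c = G / (G + D) * (G / real CARD('t) + b)"
  have GD: "G + D \<noteq> 0"
    using S by (simp add: G_def D_def)
  have total: "total_demand (sigma_profile g r w b) $ t = G / (G + D) * w_arc g r w b $ t" for t
    by (simp add: total_demand_def sigma_profile_def sum_distrib_right[symmetric]
        sum_divide_distrib[symmetric] G_def D_def total_need_def)
  have factor: "G / (G + D) - 1 = - (D / (G + D))"
    using GD by (simp add: field_simps)
  have "(total_demand (sigma_profile g r w b) + r - w) $ t = - (D / (G + D)) * (w - r) $ t + c" for t
    by (simp only: factor[symmetric])
       (simp add: total w_arc_def c_def G_def[symmetric] algebra_simps del: times_divide_eq_left)
  then have "total_demand (sigma_profile g r w b) + r - w =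
      (\<chi> t. - (D / (G + D)) * (w - r) $ t + c)"
    by (simp only: vec_eq_iff vec_lambda_beta) simp
  then have "leader_cost r w \<pi> (sigma_profile g r w b) =
      Var (\<chi> t. - (D / (G + D)) * (w - r) $ t + c)"
    by (simp only: leader_cost_def Let_def Var_def)
  also have "\<dots> = (D / (G + D))\<^sup>2 * Var (w - r)"
    by (simp only: Var_affine power2_minus)
  finally show ?thesis
    by (simp add: D_def G_def)
qed

theorem theorem3p2:
  fixes g \<nu>max :: "real ^ 'n::finite" and r w :: "real ^ 't::finite" and b :: real
  assumes "\<And>i. g $ i > 0"
    and "\<And>i. \<nu>max $ i \<ge> g $ i / real CARD('t)"
    and "\<And>t. 0 < w_arc g r w b $ t"
    and "\<And>t. w_arc g r w b $ t \<le>
           (total_need g + real CARD('t) * prediction_error r w b) *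
           Min (range (\<lambda>i. \<nu>max $ i / g $ i))"
  shows "strict_nash_equilibrium g \<nu>max (leader_strategy g r w b) (sigma_profile g r w b) \<and>
    (\<forall>\<nu>. nash_equilibrium g \<nu>max (leader_strategy g r w b) \<nu> \<longleftrightarrow> \<nu> = sigma_profile g r w b) \<and>
    leader_cost r w (leader_strategy g r w b) (sigma_profile g r w b) =
      (real CARD('t) * prediction_error r w b /
        (total_need g + real CARD('t) * prediction_error r w b))\<^sup>2 * Var (w - r)"
proof -
  define W where "W = w_arc g r w b"
  define k :: "real ^ 'n"
    where "k = (\<chi> i. g $ i / (total_need g + real CARD('t) * prediction_error r w b))"
  have W: "W $ t > 0" for t
    using assms(3) by (simp add: W_def)
  have \<pi>: "leader_strategy g r w b = (\<lambda>t y. (1 + 1 / real CARD('n)) + y / W $ t)"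
    by (intro ext) (simp add: leader_strategy_def W_def)
  have \<sigma>: "sigma_profile g r w b = (\<chi> i. k $ i *\<^sub>R W)"
    by (simp add: sigma_profile_def k_def W_def)
  have feas: "feasible g \<nu>max i (k $ i *\<^sub>R W)" for i
    using feasible_sigma_profile[OF assms(1,3,4), of i] by (simp add: \<sigma>)
  have strict: "strict_nash_equilibrium g \<nu>max (leader_strategy g r w b) (sigma_profile g r w b)"
    unfolding \<pi> \<sigma> using W feas by (rule proportional_strict_nash_equilibrium)
  moreover have "nash_equilibrium g \<nu>max (leader_strategy g r w b) \<nu> \<longleftrightarrow> \<nu> = sigma_profile g r w b" for \<nu>
  proof
    assume "nash_equilibrium g \<nu>max (leader_strategy g r w b) \<nu>"
    then show "\<nu> = sigma_profile g r w b"
      unfolding \<pi> \<sigma> by (rule nash_equilibrium_unique[OF W feas])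
  qed (use strict in \<open>simp add: strict_nash_equilibrium_def\<close>)
  moreover note leader_cost_sigma_profile[OF less_imp_neq[OF sum_w_arc_pos[OF assms(3)], symmetric]]
  ultimately show ?thesis
    by blast
qed

end
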